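(* Let $\Phi$, $\varphi$, $V$ be as in the standing assumption (see context), and suppose $\varphi\in\mathcal Z_{C_1}(\mathbb R^d)$ for some $C_1\in(0,1)$, with associated $M_\varphi$, $L_\varphi$. Suppose that there exist $\alpha\in(0,2)$ and a function $\ell$ slowly varying at zero such that $\Phi(u)\sim u^{\alpha/2}\ell(u)$ as $u\downarrow0$. If there exist (1) a decreasing function $\rho:\mathbb R^+\to\mathbb R^+$ such that $\varphi(x)=\rho(|x|)$ for $x\in B^c_{M_\varphi}(0)$; (2) $C_2,C_3,M_1>0$ and $\kappa\in\left(\frac d2,\frac{d+\alpha}2\right)$ such that $C_2|x|^{-2\kappa}\le\varphi(x)\le C_3|x|^{-2\kappa}$ for $x\in B^c_{M_1}(0)$; (3) $C_4,M_2>0$ such that $L_\varphi(x)\le C_4|x|^{-(2\kappa+2)}$ for $x\in B^c_{M_2}(0)$, then there exists $M>0$ such that $V(x)>0$ for every $x\in B^c_M(0)$.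
   Context: Notation: $\mathbb R^+=[0,\infty)$; $B_r(a)$ is the open ball in $\mathbb R^d$, $B_r^c(a)$ its complement; $D_hf(x)=f(x+h)-2f(x)+f(x-h)$. $f\sim g$ means the ratio tends to $1$. A measurable $\ell:(0,\infty)\to(0,\infty)$ is slowly varying at zero if $\widetilde\ell(t)=\ell(1/t)$ satisfies $\lim_{t\to\infty}\widetilde\ell(ct)/\widetilde\ell(t)=1$ for every $c>0$. $\Phi$ is a complete Bernstein function with Lévy pair $(0,\mu)$: $\Phi(u)=\int_0^\infty(1-e^{-ut})\mu(t)\,dt$ with $\mu:(0,\infty)\to[0,\infty)$ completely monotone and $\int_0^\infty\min(1,t)\mu(t)\,dt<\infty$. The jump kernel is $j(r)=(4\pi)^{-d/2}\int_0^\infty t^{-d/2}e^{-r^2/(4t)}\mu(t)\,dt$, $r>0$. $\Phi(-\Delta)$ is the operator on $L^2(\mathbb R^d)$ with Fourier multiplier $\Phi(|y|^2)$. Standing assumption: $V:\mathbb R^d\to\mathbb R$ is a potential, $H=\Phi(-\Delta)+V$, and $\varphi\in L^2(\mathbb R^d)\cap L^\infty(\mathbb R^d)$, $\varphi>0$, satisfies $H\varphi=0$. The potential is understood through the pointwise expression $V(x)=-\frac{1}{\varphi(x)}\Phi(-\Delta)\varphi(x)=\frac{1}{2\varphi(x)}\int_{\mathbb R^d}D_h\varphi(x)\,j(|h|)\,dh$. Space: for $C\in(0,1)$, $\mathcal Z_C(\mathbb R^d)$ is the set of $f\in L^\infty(\mathbb R^d)$ for which there exist $M_f>0$ and $L_f\in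 L^\infty(B^c_{M_f}(0))$ such that $|D_hf(x)|\le L_f(x)|h|^2$ for all $x\in B^c_{M_f}(0)$ and $h\in B_{C|x|}(0)$. *)

theory Defs
  imports "HOL-Analysis.Analysis" "HOL-Library.Landau_Symbols"
begin

text \<open>Points of the Euclidean space are elements of a type of class \<open>euclidean_space\<close>, of
  dimension \<open>d = DIM('a)\<close>. The complement of the open ball of radius \<open>r\<close> about \<open>0\<close> is
  \<open>- ball 0 r\<close>. Function spaces are taken with respect to Lebesgue measure, for actual functions
  rather than classes modulo null sets.\<close>

definition Linfty :: "'a measure \<Rightarrow> ('a \<Rightarrow> real) \<Rightarrow> bool" where
  "Linfty M f \<longleftrightarrow> f \<in> borel_measurable M \<and> (\<exists>K. AE x in M. \<bar>f x\<bar> \<le> K)"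

definition L2 :: "'a measure \<Rightarrow> ('a \<Rightarrow> 'b::{real_normed_vector, second_countable_topology}) \<Rightarrow> bool" where
  "L2 M f \<longleftrightarrow> f \<in> borel_measurable M \<and> integrable M (\<lambda>x. (norm (f x))\<^sup>2)"


definition second_diff :: "'a::real_vector \<Rightarrow> ('a \<Rightarrow> real) \<Rightarrow> 'a \<Rightarrow> real" where
  "second_diff h f x = f (x + h) - 2 * f x + f (x - h)"

definition Zygmund_bound ::
    "real \<Rightarrow> ('a::euclidean_space \<Rightarrow> real) \<Rightarrow> real \<Rightarrow> ('a \<Rightarrow> real) \<Rightarrow> bool" where
  "Zygmund_bound C f M L \<longleftrightarrow>
     M > 0 \<and> Linfty (lebesgue_on (- ball 0 M)) L \<and>
     (\<forall>x \<in> - ball 0 M. \<forall>h \<in> ball 0 (C * norm x). \<bar>second_diff h f x\<bar> \<le> L x * (norm h)\<^sup>2)"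

definition Zspace :: "real \<Rightarrow> ('a::euclidean_space \<Rightarrow> real) set" where
  "Zspace C = {f. Linfty lebesgue f \<and> (\<exists>M L. Zygmund_bound C f M L)}"


definition slowly_varying_at_zero :: "(real \<Rightarrow> real) \<Rightarrow> bool" where
  "slowly_varying_at_zero l \<longleftrightarrow>
     l \<in> borel_measurable (lebesgue_on {0<..}) \<and> (\<forall>t>0. l t > 0) \<and>
     (\<forall>c>0. ((\<lambda>t. l (1 / (c * t)) / l (1 / t)) \<longlongrightarrow> 1) at_top)"

definition completely_monotone :: "(real \<Rightarrow> real) \<Rightarrow> bool" where
  "completely_monotone f \<longleftrightarrow>
     (\<forall>n. \<forall>t>0. (deriv ^^ n) f differentiable (at t) \<and> 0 \<le> (-1) ^ n * (deriv ^^ n) f t)"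

text \<open>\<open>\<Phi>\<close> is the complete Bernstein function with zero drift whose Levy measure has the density
  \<open>\<mu>\<close>; only the values of \<open>\<Phi>\<close> and \<open>\<mu>\<close> on the open half-line matter.\<close>
definition complete_Bernstein_pair :: "(real \<Rightarrow> real) \<Rightarrow> (real \<Rightarrow> real) \<Rightarrow> bool" where
  "complete_Bernstein_pair \<Phi> \<mu> \<longleftrightarrow>
     completely_monotone \<mu> \<and>
     set_integrable lborel {0<..} (\<lambda>t. min 1 t * \<mu> t) \<and>
     (\<forall>u>0. \<Phi> u = (LINT t:{0<..}|lborel. (1 - exp (- u * t)) * \<mu> t))"

definition jump_kernel :: "nat \<Rightarrow> (real \<Rightarrow> real) \<Rightarrow> real \<Rightarrow> real" where
  "jump_kernel d \<mu> r = (4 * pi) powr (- real d / 2) *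
     (LINT t:{0<..}|lborel. t powr (- real d / 2) * exp (- r\<^sup>2 / (4 * t)) * \<mu> t)"


text \<open>\<open>F\<close> represents the Fourier--Plancherel transform of the square integrable function \<open>f\<close>: the
  \<open>L\<^sup>2\<close> limit of the Fourier integrals over balls. The nonnegative integral is used because its
  value is meaningful without an integrability proof.\<close>
definition L2_Fourier :: "('a::euclidean_space \<Rightarrow> complex) \<Rightarrow> ('a \<Rightarrow> complex) \<Rightarrow> bool" where
  "L2_Fourier f F \<longleftrightarrow> L2 lebesgue f \<and> L2 lebesgue F \<and>
     ((\<lambda>R. \<integral>\<^sup>+y. ennreal ((norm (F y - (2 * pi) powr (- real DIM('a) / 2) *\<^sub>R
              (LINT x:cball 0 R|lebesgue. cis (- (x \<bullet> y)) * f x)))\<^sup>2) \<partial>lebesgue)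
        \<longlongrightarrow> 0) at_top"

text \<open>The graph of the Fourier multiplier operator with symbol \<open>m\<close> on real-valued functions:
  \<open>f\<close> lies in the domain (\<open>m\<close> times the transform of \<open>f\<close> is square integrable) and \<open>g\<close> is a
  representative of the image of \<open>f\<close>.\<close>
definition Fourier_multiplier ::
    "('a::euclidean_space \<Rightarrow> real) \<Rightarrow> ('a \<Rightarrow> real) \<Rightarrow> ('a \<Rightarrow> real) \<Rightarrow> bool" where
  "Fourier_multiplier m f g \<longleftrightarrow>
     (\<exists>F. L2_Fourier (\<lambda>x. complex_of_real (f x)) F \<and>
          L2_Fourier (\<lambda>x. complex_of_real (g x)) (\<lambda>y. complex_of_real (m y) * F y))"

definition Phi_Laplacian ::
    "(real \<Rightarrow> real) \<Rightarrow> ('a::euclidean_space \<Rightarrow> real) \<Rightarrow> ('a \<Rightarrow> real) \<Rightarrow> bool" where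
  "Phi_Laplacian \<Phi> = Fourier_multiplier (\<lambda>y. \<Phi> ((norm y)\<^sup>2))"

text \<open>The graph of \<open>H = \<Phi>(-\<Delta>) + V\<close>, with \<open>V\<close> acting by multiplication.\<close>
definition Schroedinger ::
    "(real \<Rightarrow> real) \<Rightarrow> ('a::euclidean_space \<Rightarrow> real) \<Rightarrow> ('a \<Rightarrow> real) \<Rightarrow> ('a \<Rightarrow> real) \<Rightarrow> bool" where
  "Schroedinger \<Phi> V f g \<longleftrightarrow>
     (\<exists>u. Phi_Laplacian \<Phi> f u \<and> L2 lebesgue (\<lambda>x. V x * f x) \<and>
          (AE x in lebesgue. g x = u x + V x * f x))"

text \<open>The pointwise representation of the potential. It is imposed exactly at the points where the
  integral converges absolutely, since elsewhere the Bochner integral has the meaningless value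
  \<open>0\<close>. For \<open>\<phi>\<close> in a Zygmund-type space above these include all points outside a ball.\<close>
definition potential_pointwise ::
    "(real \<Rightarrow> real) \<Rightarrow> ('a::euclidean_space \<Rightarrow> real) \<Rightarrow> ('a \<Rightarrow> real) \<Rightarrow> bool" where
  "potential_pointwise \<mu> \<phi> V \<longleftrightarrow>
     (\<forall>x. integrable lebesgue (\<lambda>h. second_diff h \<phi> x * jump_kernel DIM('a) \<mu> (norm h)) \<longrightarrow>
          V x = 1 / (2 * \<phi> x) *
            (LINT h|lebesgue. second_diff h \<phi> x * jump_kernel DIM('a) \<mu> (norm h)))"

end

theory Submission
  imports Defs "HOL-Probability.Distributions"
begin

text \<open>
  At a point \<open>x\<close> with \<open>|x| = R\<close> large, the sign of \<open>V x\<close> is the sign of the integral of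
  \<open>second_diff h \<phi> x\<close> against the jump kernel \<open>j(|h|)\<close>, and this integral is a competition between
  two terms that both contain the factor \<open>\<Phi> (1 / R\<^sup>2)\<close>.

  The loss is governed by the size of \<open>\<phi>\<close> near \<open>x\<close>. For \<open>|h| < C1 R\<close> the Zygmund bound gives
  \<open>|second_diff h \<phi> x| \<le> C4 R\<^bsup>- 2 \<kappa>\<^esup> |h|\<^sup>2 / R\<^sup>2\<close>; for larger \<open>h\<close> only the term \<open>- 2 \<phi> x\<close> is
  negative, and it is at least \<open>- 2 C3 R\<^bsup>- 2 \<kappa>\<^esup>\<close>. So the loss is at most a multiple of
  \<open>R\<^bsup>- 2 \<kappa>\<^esup> min 1 (|h|\<^sup>2 / R\<^sup>2)\<close>. The jump kernel is a mixture of heat kernels with weight \<open>\<mu>\<close>, and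
  the integral of \<open>min 1 (|h|\<^sup>2 / R\<^sup>2)\<close> against the heat kernel at time \<open>t\<close> is at most of
  order \<open>min 1 (t / R\<^sup>2)\<close>, that is, of order \<open>1 - exp (- t / R\<^sup>2)\<close>. Integrating in \<open>t\<close> bounds the loss by a
  multiple of \<open>R\<^bsup>- 2 \<kappa>\<^esup> \<Phi> (1 / R\<^sup>2)\<close>
  (\<open>truncated_second_moment_jump_kernel_le\<close>).

  The gain comes from the bulk of \<open>\<phi>\<close>, which jumps of length about \<open>R\<close> see from \<open>x\<close>: on a fixed
  ball \<open>\<phi>\<close> is bounded below, so the gain is at least a multiple of the least value of the kernel at
  distances up to \<open>2 R\<close>. This value is at least a multiple of \<open>R\<^bsup>- d\<^esup> \<Phi> (1 / R\<^sup>2)\<close>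
  (\<open>jump_kernel_ge_Bernstein_function\<close>). Here the regular variation of \<open>\<Phi>\<close> at \<open>0\<close> with an index
  strictly between \<open>0\<close> and \<open>1\<close> enters: it forces the jump times comparable with \<open>R\<^sup>2\<close> to carry a
  fixed share of \<open>\<Phi> (1 / R\<^sup>2)\<close> (\<open>Levy_mass_ge_Bernstein_function\<close>).

  Since \<open>2 \<kappa> > d\<close>, the gain wins for large \<open>R\<close>.
\<close>

section \<open>The heat kernel\<close>

definition heat_kernel :: "real \<Rightarrow> 'a::euclidean_space \<Rightarrow> real" where
  "heat_kernel t h = (4 * pi * t) powr (- real DIM('a) / 2) * exp (- (norm h)\<^sup>2 / (4 * t))"

lemma heat_kernel_nonneg: "0 \<le> heat_kernel t h"
  by (simp add: heat_kernel_def)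

lemma heat_kernel_measurable [measurable]:
  "case_prod heat_kernel \<in> borel_measurable (borel \<Otimes>\<^sub>M (borel :: 'a::euclidean_space measure))"
  unfolding heat_kernel_def split_beta' by measurable

text \<open>The Gaussian factorises over the coordinates, which reduces its integral to the
  one-dimensional normal density of variance \<open>2 t\<close>.\<close>

lemma heat_kernel_eq_prod_normal_density:
  fixes h :: "'a::euclidean_space"
  assumes "t > 0"
  shows "heat_kernel t h = (\<Prod>b\<in>Basis. normal_density 0 (sqrt (2 * t)) (h \<bullet> b))"
proof -
  have "(\<Prod>b\<in>Basis. normal_density 0 (sqrt (2 * t)) (h \<bullet> b))
      = (\<Prod>b\<in>(Basis::'a set). 1 / sqrt (4 * pi * t)) * (\<Prod>b\<in>Basis. exp (- (h \<bullet> b)\<^sup>2 / (4 * t)))"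
    unfolding prod.distrib[symmetric]
  proof (rule prod.cong[OF refl])
    fix b :: 'a
    have "2 * pi * (sqrt (2 * t))\<^sup>2 = 4 * pi * t" "2 * (sqrt (2 * t))\<^sup>2 = 4 * t" using assms by simp_all
    then show "normal_density 0 (sqrt (2 * t)) (h \<bullet> b) = 1 / sqrt (4 * pi * t) * exp (- (h \<bullet> b)\<^sup>2 / (4 * t))"
      by (simp add: normal_density_def)
  qed
  also have "(\<Prod>b\<in>(Basis::'a set). 1 / sqrt (4 * pi * t)) = ((4 * pi * t) powr - (1 / 2)) ^ DIM('a)"
    using assms by (simp add: powr_minus_divide powr_half_sqrt)
  also have "\<dots> = (4 * pi * t) powr (- real DIM('a) / 2)"
    using assms by (simp add: powr_power mult.commute)
  also have "(\<Prod>b\<in>Basis. exp (- (h \<bullet> b)\<^sup>2 / (4 * t))) = exp (\<Sum>b\<in>Basis. - (h \<bullet> b)\<^sup>2 / (4 * t))"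
    by (simp add: exp_sum)
  also have "(\<Sum>b\<in>Basis. - (h \<bullet> b)\<^sup>2 / (4 * t)) = - (norm h)\<^sup>2 / (4 * t)"
    by (simp add: sum_divide_distrib[symmetric] sum_negf norm_eq_sqrt_inner euclidean_inner[of h h]
          power2_eq_square sum_nonneg)
  finally show ?thesis by (simp add: heat_kernel_def)
qed

lemma nn_integral_heat_kernel:
  assumes "t > 0"
  shows "(\<integral>\<^sup>+ h. ennreal (heat_kernel t h) \<partial>(lborel :: 'a::euclidean_space measure)) = 1"
proof -
  have s: "sqrt (2 * t) > 0" using assms by simp
  have "(\<integral>\<^sup>+ h. ennreal (heat_kernel t h) \<partial>(lborel :: 'a measure))
     = (\<integral>\<^sup>+ h. (\<Prod>b\<in>Basis. ennreal (normal_density 0 (sqrt (2 * t)) (h \<bullet> b))) \<partial>(lborel :: 'a measure))"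
    by (simp add: heat_kernel_eq_prod_normal_density[OF assms] prod_ennreal)
  also have "\<dots> = (\<Prod>b\<in>(Basis::'a set). \<integral>\<^sup>+ x. ennreal (normal_density 0 (sqrt (2 * t)) x) \<partial>lborel)"
    by (rule nn_integral_lborel_prod) auto
  also have "\<dots> = 1"
    using integrable_normal_density[OF s] integral_normal_density[OF s]
    by (simp add: nn_integral_eq_integral)
  finally show ?thesis .
qed

text \<open>A moment bound without computing a second moment: \<open>s \<le> exp s\<close> with
  \<open>s = |h|\<^sup>2 / (8 t)\<close> lets half of the Gaussian exponent absorb the factor \<open>|h|\<^sup>2\<close>. What is
  left is the heat kernel at time \<open>2 t\<close>, up to a constant times \<open>t\<close>, and that one has mass \<open>1\<close>.\<close>

lemma norm_sq_heat_kernel_le: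
  fixes h :: "'a::euclidean_space"
  assumes "t > 0"
  shows "(norm h)\<^sup>2 * heat_kernel t h \<le> 8 * 2 powr (real DIM('a) / 2) * t * heat_kernel (2 * t) h"
proof -
  define s where "s = (norm h)\<^sup>2 / (8 * t)"
  have h: "(norm h)\<^sup>2 = 8 * t * s" using assms by (simp add: s_def)
  have "s \<le> exp s" using exp_ge_add_one_self[of s] by linarith
  then have "s * exp (- (2 * s)) \<le> exp s * exp (- (2 * s))" by (intro mult_right_mono) auto
  also have "\<dots> = exp (- s)" by (simp flip: exp_add)
  finally have *: "s * exp (- (2 * s)) \<le> exp (- s)" .
  have p: "2 powr (real DIM('a) / 2) * (4 * pi * (2 * t)) powr (- real DIM('a) / 2)
      = (4 * pi * t) powr (- real DIM('a) / 2)"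
  proof -
    have "(4 * pi * (2 * t)) powr (- real DIM('a) / 2)
        = (4 * pi * t) powr (- real DIM('a) / 2) * 2 powr (- real DIM('a) / 2)"
      using assms by (subst powr_mult[symmetric]) (auto simp: mult_ac)
    then show ?thesis by (simp add: mult.left_commute powr_add[symmetric])
  qed
  have e1: "- (norm h)\<^sup>2 / (4 * t) = - (2 * s)" and e2: "- (norm h)\<^sup>2 / (4 * (2 * t)) = - s"
    using assms by (auto simp: h)
  have "(norm h)\<^sup>2 * heat_kernel t h
      = (8 * t * (4 * pi * t) powr (- real DIM('a) / 2)) * (s * exp (- (2 * s)))"
    unfolding heat_kernel_def e1 h by simp
  also have "\<dots> \<le> (8 * t * (4 * pi * t) powr (- real DIM('a) / 2)) * exp (- s)"
    using assms by (intro mult_left_mono *) auto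
  also have "\<dots> = 8 * 2 powr (real DIM('a) / 2) * t * heat_kernel (2 * t) h"
    unfolding heat_kernel_def e2 p[symmetric] by simp
  finally show ?thesis .
qed

lemma min_one_le_exp:
  fixes s :: real
  assumes "0 \<le> s"
  shows "min 1 s \<le> 2 * (1 - exp (- s))"
proof -
  define r where "r = min 1 s"
  have r: "0 \<le> r" "r \<le> 1" "r \<le> s" using assms by (auto simp: r_def)
  have "exp (- s) \<le> exp (- r)" using r by simp
  also have "\<dots> \<le> 1 / (1 + r)"
    using exp_ge_add_one_self[of r] r by (simp add: exp_minus field_simps)
  also have "\<dots> \<le> 1 - r / 2"
  proof -
    have "(1 - r / 2) * (1 + r) = 1 + r * (1 - r) / 2" by (simp add: field_simps)
    moreover have "0 \<le> r * (1 - r)" using r by simp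
    ultimately have "1 \<le> (1 - r / 2) * (1 + r)" by linarith
    then show ?thesis using r by (simp add: divide_le_eq)
  qed
  finally have "r / 2 \<le> 1 - exp (- s)" by simp
  then show ?thesis unfolding r_def[symmetric] by simp
qed

text \<open>The integral is at most \<open>1\<close> (total mass) and at most a multiple of \<open>t / r\<^sup>2\<close> (second
  moment). The minimum of the two is comparable with \<open>1 - exp (- t / r\<^sup>2)\<close>, the integrand in the
  representation of \<open>\<Phi>\<close> at the point \<open>1 / r\<^sup>2\<close>.\<close>

lemma truncated_second_moment_heat_kernel_le:
  assumes "t > 0" "r > 0"
  shows "(\<integral>\<^sup>+ h. ennreal (min 1 ((norm h)\<^sup>2 / r\<^sup>2) * heat_kernel t h) \<partial>(lborel :: 'a::euclidean_space measure))
     \<le> ennreal (16 * 2 powr (real DIM('a) / 2) * (1 - exp (- (1 / r\<^sup>2) * t)))" (is "?I \<le> ennreal (16 * ?c * _)")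
proof -
  have "?I \<le> (\<integral>\<^sup>+ h. ennreal (heat_kernel t h) \<partial>(lborel :: 'a measure))"
    by (intro nn_integral_mono ennreal_leI mult_left_le_one_le) (auto simp: heat_kernel_nonneg)
  then have I1: "?I \<le> ennreal 1"
    using nn_integral_heat_kernel[OF assms(1), where ?'a = 'a] by simp
  have "min 1 ((norm h)\<^sup>2 / r\<^sup>2) * heat_kernel t h \<le> 8 * ?c * (t / r\<^sup>2) * heat_kernel (2 * t) h" for h :: 'a
  proof -
    have "min 1 ((norm h)\<^sup>2 / r\<^sup>2) * heat_kernel t h \<le> (norm h)\<^sup>2 * heat_kernel t h / r\<^sup>2"
      using mult_right_mono[OF min.cobounded2 heat_kernel_nonneg[of t h], of 1 "(norm h)\<^sup>2 / r\<^sup>2"]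
      by simp
    also have "\<dots> \<le> 8 * ?c * t * heat_kernel (2 * t) h / r\<^sup>2"
      by (intro divide_right_mono norm_sq_heat_kernel_le assms) auto
    finally show ?thesis by simp
  qed
  then have "?I \<le> (\<integral>\<^sup>+ h. ennreal (8 * ?c * (t / r\<^sup>2)) * ennreal (heat_kernel (2 * t) h) \<partial>(lborel :: 'a measure))"
    using assms by (intro nn_integral_mono) (auto simp: ennreal_mult[symmetric] heat_kernel_nonneg intro!: ennreal_leI)
  also have "\<dots> = ennreal (8 * ?c * (t / r\<^sup>2))"
    using assms nn_integral_heat_kernel[of "2 * t", where ?'a = 'a] by (subst nn_integral_cmult) auto
  finally have "?I \<le> ennreal (min 1 (8 * ?c * (t / r\<^sup>2)))" using I1 by (auto simp: min_def)
  also have "\<dots> \<le> ennreal (16 * ?c * (1 - exp (- (1 / r\<^sup>2) * t)))"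
  proof (rule ennreal_leI)
    have "1 \<le> 8 * ?c" using ge_one_powr_ge_zero[of 2 "real DIM('a) / 2"] by simp
    then have "min 1 (8 * ?c * (t / r\<^sup>2)) \<le> 8 * ?c * min 1 (t / r\<^sup>2)"
      by (auto simp: min_def)
    also have "\<dots> \<le> 8 * ?c * (2 * (1 - exp (- (t / r\<^sup>2))))"
      using assms by (intro mult_left_mono min_one_le_exp) auto
    finally show "min 1 (8 * ?c * (t / r\<^sup>2)) \<le> 16 * ?c * (1 - exp (- (1 / r\<^sup>2) * t))"
      by (simp only: minus_mult_left[symmetric] times_divide_eq_left mult_1 mult.assoc)
  qed
  finally show ?thesis .
qed

section \<open>Regular variation of the Bernstein function\<close>

lemma regularly_varying_scaling:
  fixes \<Phi> l :: "real \<Rightarrow> real"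
  assumes l: "slowly_varying_at_zero l"
    and equiv: "\<Phi> \<sim>[at_right 0] (\<lambda>u. u powr a * l u)"
    and c: "c > 0"
  shows "((\<lambda>u. \<Phi> (c * u) / \<Phi> u) \<longlongrightarrow> c powr a) (at_right 0)"
proof -
  define g where "g = (\<lambda>u. u powr a * l u)"
  have pos: "eventually (\<lambda>u::real. 0 < u) (at_right 0)" by (simp add: eventually_at_right_less)
  have gpos: "g u > 0" if "u > 0" for u
    using l that by (auto simp: g_def slowly_varying_at_zero_def)
  have 1: "((\<lambda>u. \<Phi> u / g u) \<longlongrightarrow> 1) (at_right 0)"
    using asymp_equivD[OF equiv]
  proof (rule Lim_transform_eventually)
    show "\<forall>\<^sub>F u in at_right 0. (if \<Phi> u = 0 \<and> u powr a * l u = 0 then 1 else \<Phi> u / (u powr a * l u)) = \<Phi> u / g u"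
      using pos
    proof eventually_elim
      case (elim u)
      then show ?case using gpos[OF elim] by (auto simp: g_def)
    qed
  qed
  have "filterlim (\<lambda>u. c * u) (at_right 0) (at_right 0)"
    using filterlim_times_pos[OF filterlim_ident c, of 0 0] by (simp add: mult.commute)
  then have 2: "((\<lambda>u. \<Phi> (c * u) / g (c * u)) \<longlongrightarrow> 1) (at_right 0)"
    by (rule filterlim_compose[OF 1])
  have "((\<lambda>t. l (1 / (1 / c * t)) / l (1 / t)) \<longlongrightarrow> 1) at_top"
    using l divide_pos_pos[OF zero_less_one c] unfolding slowly_varying_at_zero_def by blast
  from filterlim_compose[OF this filterlim_inverse_at_top_right]
  have "((\<lambda>u. l (c * u) / l u) \<longlongrightarrow> 1) (at_right 0)"
    by (simp add: divide_inverse mult.commute)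
  then have "((\<lambda>u. \<Phi> (c * u) / g (c * u) * (c powr a * (l (c * u) / l u)) / (\<Phi> u / g u)) \<longlongrightarrow> 1 * (c powr a * 1) / 1) (at_right 0)"
    by (intro tendsto_mult tendsto_divide tendsto_const 1 2) simp_all
  moreover have "\<forall>\<^sub>F u in at_right 0. \<Phi> (c * u) / g (c * u) * (c powr a * (l (c * u) / l u)) / (\<Phi> u / g u) = \<Phi> (c * u) / \<Phi> u"
    using pos
  proof eventually_elim
    case (elim u)
    have "c powr a * (l (c * u) / l u) = g (c * u) / g u"
      using elim c by (simp add: g_def powr_mult)
    then show ?case using gpos[of u] gpos[of "c * u"] elim c by simp
  qed
  ultimately show ?thesis by (simp add: Lim_transform_eventually)
qed

lemma regularly_varying_pos:
  fixes \<Phi> l :: "real \<Rightarrow> real"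
  assumes l: "slowly_varying_at_zero l"
    and equiv: "\<Phi> \<sim>[at_right 0] (\<lambda>u. u powr a * l u)"
  shows "\<forall>\<^sub>F u in at_right 0. \<Phi> u > 0"
proof -
  have "\<forall>\<^sub>F u in at_right 0. u powr a * l u > 0"
    using eventually_at_right_less[of 0] l
    by (auto elim!: eventually_mono simp: slowly_varying_at_zero_def)
  then show ?thesis 
    using asymp_equiv_eventually_pos_iff[OF equiv] by (auto elim: eventually_elim2)
qed

context
  fixes \<Phi> \<mu> :: "real \<Rightarrow> real"
  assumes pair: "complete_Bernstein_pair \<Phi> \<mu>"
begin

lemma Levy_density_nonneg: "t > 0 \<Longrightarrow> 0 \<le> \<mu> t"
  and Levy_density_differentiable: "t > 0 \<Longrightarrow> \<mu> differentiable (at t)"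
  using pair unfolding complete_Bernstein_pair_def completely_monotone_def
  by (auto dest!: conjunct1 dest: spec[of _ 0])

lemma Levy_density_measurable [measurable]: "(\<lambda>t. indicator {0<..} t * \<mu> t) \<in> borel_measurable borel"
proof -
  have "continuous_on {0<..} \<mu>"
    by (intro continuous_at_imp_continuous_on ballI differentiable_imp_continuous_within
          Levy_density_differentiable) simp
  then show ?thesis
    using borel_measurable_continuous_on_indicator[of "{0<..}" \<mu>] by simp
qed

lemma Levy_density_integrable_if_dominated:
  assumes [measurable]: "f \<in> borel_measurable borel"
    and le: "\<And>t. t > 0 \<Longrightarrow> \<bar>f t\<bar> \<le> K * min 1 t"
  shows "set_integrable lborel {0<..} (\<lambda>t. f t * \<mu> t)"
proof -
  have "set_integrable lborel {0<..} (\<lambda>t. min 1 t * \<mu> t)"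
    using pair by (simp add: complete_Bernstein_pair_def)
  then have "integrable lborel (\<lambda>t. K * (indicator {0<..} t * (min 1 t * \<mu> t)))"
    by (simp add: set_integrable_def)
  then have "integrable lborel (\<lambda>t. f t * (indicator {0<..} t * \<mu> t))"
  proof (rule Bochner_Integration.integrable_bound)
    show "AE t in lborel. norm (f t * (indicator {0<..} t * \<mu> t)) \<le> norm (K * (indicator {0<..} t * (min 1 t * \<mu> t)))"
    proof (rule AE_I2)
      fix t :: real
      show "norm (f t * (indicator {0<..} t * \<mu> t)) \<le> norm (K * (indicator {0<..} t * (min 1 t * \<mu> t)))"
      proof (cases "t > 0")
        case True
        then have "\<bar>f t\<bar> * \<mu> t \<le> \<bar>K * min 1 t\<bar> * \<mu> t"
          using le[OF True] Levy_density_nonneg[OF True] by (intro mult_right_mono) linarith+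
        then show ?thesis using True Levy_density_nonneg[OF True] by (simp add: abs_mult)
      qed simp
    qed
  qed measurable
  then show ?thesis by (simp add: set_integrable_def mult_ac)
qed

lemma Bernstein_integrable:
  assumes "u > 0"
  shows "set_integrable lborel {0<..} (\<lambda>t. (1 - exp (- u * t)) * \<mu> t)"
proof (rule Levy_density_integrable_if_dominated[where K = "max 1 u"])
  fix t :: real assume t: "t > 0"
  have "1 - exp (- u * t) \<le> u * t" using exp_ge_add_one_self[of "- u * t"] by simp
  also have "\<dots> \<le> max 1 u * t" using t by (intro mult_right_mono) auto
  finally have "1 - exp (- u * t) \<le> max 1 u * t" .
  moreover have "1 - exp (- u * t) \<le> max 1 u" by (simp add: le_max_iff_disj)
  ultimately show "\<bar>1 - exp (- u * t)\<bar> \<le> max 1 u * min 1 t"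
    using t assms by (simp add: min_def)
qed measurable

lemma Levy_density_integrable_Icc:
  assumes "a > 0"
  shows "set_integrable lborel {0<..} (\<lambda>t. indicator {a..b} t * \<mu> t)"
proof (rule Levy_density_integrable_if_dominated[where K = "max 1 (1 / a)"])
  fix t :: real assume t: "t > 0"
  have "1 \<le> max 1 (1 / a) * min 1 t" if "a \<le> t"
  proof -
    have "1 \<le> 1 / a * t" using that assms by simp
    also have "\<dots> \<le> max 1 (1 / a) * t" using t by (intro mult_right_mono) auto
    finally have "1 \<le> max 1 (1 / a) * t" .
    moreover have "1 \<le> max 1 (1 / a) * 1" by simp
    ultimately show ?thesis unfolding min_def by presburger
  qed
  moreover have "0 \<le> max 1 (1 / a) * min 1 t" using t by simp
  ultimately show "\<bar>indicator {a..b} t\<bar> \<le> max 1 (1 / a) * min 1 t" 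
    by (auto simp: indicator_def)
qed measurable

text \<open>The Levy measure is split at \<open>e / u\<close> and \<open>L / u\<close>. Below \<open>e / u\<close> the integrand \<open>1 - exp (- u t)\<close> is
  at most \<open>u t = e (u / e) t\<close>, and \<open>(u / e) t \<le> 1\<close> is comparable with \<open>1 - exp (- (u / e) t)\<close>. Above
  \<open>L / u\<close> both \<open>1 - exp (- u t)\<close> and \<open>1 - exp (- (u / L) t)\<close> are of order \<open>1\<close>. So the two ends are
  controlled by \<open>\<Phi>\<close> itself at the rescaled points \<open>u / e\<close> and \<open>u / L\<close>.\<close>

lemma Bernstein_function_le_three_scales:
  assumes u: "u > 0" and e: "e > 0" and L: "L > 0"
  shows "\<Phi> u \<le> 2 * e * \<Phi> (u / e) + 2 * \<Phi> (u / L) + (LINT t:{0<..}|lborel. indicator {e / u..L / u} t * \<mu> t)"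
proof -
  have \<Phi>: "\<Phi> v = (LINT t:{0<..}|lborel. (1 - exp (- v * t)) * \<mu> t)" if "v > 0" for v
    using pair that by (simp add: complete_Bernstein_pair_def)
  have pos: "u / e > 0" "u / L > 0" "e / u > 0" using assms by auto
  note ints = Bernstein_integrable[OF u] Bernstein_integrable[OF pos(1)] Bernstein_integrable[OF pos(2)]
    Levy_density_integrable_Icc[OF pos(3), of "L / u"]
  let ?g = "\<lambda>t. 2 * e * ((1 - exp (- (u / e) * t)) * \<mu> t) + 2 * ((1 - exp (- (u / L) * t)) * \<mu> t)
      + indicator {e / u..L / u} t * \<mu> t"
  have g: "set_integrable lborel {0<..} ?g"
    using ints by (intro set_integral_add set_integrable_mult_right) auto
  have "(LINT t:{0<..}|lborel. (1 - exp (- u * t)) * \<mu> t) \<le> (LINT t:{0<..}|lborel. ?g t)"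
  proof (rule set_integral_mono[OF ints(1) g])
    fix t :: real assume "t \<in> {0<..}"
    then have t: "t > 0" by simp
    have a: "1 - exp (- u * t) \<le> u * t" using exp_ge_add_one_self[of "- u * t"] by simp
    have b: "min 1 (u / v * t) \<le> 2 * (1 - exp (- (u / v) * t))" if "v > 0" for v
      using min_one_le_exp[of "u / v * t"] that t u by simp
    have nn: "0 \<le> 1 - exp (- (u / v) * t)" if "v > 0" for v
      using that t u by simp
    consider "u * t \<le> e" | "L \<le> u * t" | "e / u \<le> t" "t \<le> L / u"
      using u by (cases "u * t \<le> e"; cases "L \<le> u * t") (simp_all add: field_simps)
    then have "1 - exp (- u * t) \<le> 2 * e * (1 - exp (- (u / e) * t)) + 2 * (1 - exp (- (u / L) * t))
        + indicator {e / u..L / u} t"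
    proof cases
      case 1
      then have "u / e * t \<le> 1" using e by (simp add: field_simps)
      then have "u / e * t \<le> 2 * (1 - exp (- (u / e) * t))"
        using b[OF e] by (simp only: min_absorb2)
      then have "e * (u / e * t) \<le> e * (2 * (1 - exp (- (u / e) * t)))"
        using e by (intro mult_left_mono) simp_all
      also have "\<dots> = 2 * e * (1 - exp (- (u / e) * t))" by simp
      finally have "1 - exp (- u * t) \<le> 2 * e * (1 - exp (- (u / e) * t))"
        using a e by simp
      then show ?thesis using nn[OF L] by (intro add_increasing2) simp_all
    next
      case 2
      then have "1 \<le> u / L * t" using L by (simp add: field_simps)
      then have "1 \<le> 2 * (1 - exp (- (u / L) * t))" using b[OF L] by (auto simp: min_def)
      then have "1 - exp (- u * t) \<le> 2 * (1 - exp (- (u / L) * t))"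
        by (rule order_trans[rotated]) simp
      then show ?thesis using nn[OF e] e by (intro add_increasing2 add_increasing) simp_all
    next
      case 3
      then have "1 - exp (- u * t) \<le> (indicator {e / u..L / u} t :: real)" by simp
      then show ?thesis
        using nn[OF L] nn[OF e] e by (intro add_increasing add_nonneg_nonneg) simp_all
    qed
    from mult_right_mono[OF this Levy_density_nonneg[OF t]]
    show "(1 - exp (- u * t)) * \<mu> t \<le> ?g t" by (simp add: algebra_simps)
  qed
  also have "\<dots> = 2 * e * (LINT t:{0<..}|lborel. (1 - exp (- (u / e) * t)) * \<mu> t)
      + 2 * (LINT t:{0<..}|lborel. (1 - exp (- (u / L) * t)) * \<mu> t)
      + (LINT t:{0<..}|lborel. indicator {e / u..L / u} t * \<mu> t)"
    using ints by (simp add: set_integral_add set_integrable_mult_right del: mult_minus_left)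
  finally show ?thesis unfolding \<Phi>[OF u] \<Phi>[OF pos(1)] \<Phi>[OF pos(2)] .
qed

text \<open>A Tauberian statement: the jumps of size comparable with \<open>1 / u\<close> carry a fixed share of
  \<open>\<Phi> u\<close>. By regular variation the two end terms of the preceding lemma are about
  \<open>2 e\<^bsup>1 - a\<^esup> \<Phi> u\<close> and \<open>2 L\<^bsup>- a\<^esup> \<Phi> u\<close>; since \<open>0 < a < 1\<close>, both are small for small \<open>e\<close> and
  large \<open>L\<close>.\<close>

lemma Levy_mass_ge_Bernstein_function:
  assumes l: "slowly_varying_at_zero l"
    and equiv: "\<Phi> \<sim>[at_right 0] (\<lambda>u. u powr a * l u)"
    and a: "0 < a" "a < 1"
  shows "\<exists>e>0. \<exists>L>0. \<forall>\<^sub>F u in at_right 0.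
           \<Phi> u / 2 \<le> (LINT t:{0<..}|lborel. indicator {e / u..L / u} t * \<mu> t)"
proof -
  \<comment> \<open>Chosen so that \<open>e\<^bsup>1 - a\<^esup> = L\<^bsup>- a\<^esup> = 1 / 16\<close>: each end term is then about \<open>\<Phi> u / 8\<close>, hence
    below \<open>\<Phi> u / 4\<close> for small \<open>u\<close>.\<close>
  define e :: real where "e = (1 / 16) powr (1 / (1 - a))"
  define L :: real where "L = 16 powr (1 / a)"
  have e: "e > 0" and L: "L > 0" by (auto simp: e_def L_def)
  have "e * (1 / e) powr a = e powr (1 - a)"
    using e by (simp add: powr_divide powr_diff)
  also have "\<dots> = 1 / 16" using a by (simp add: e_def powr_powr)
  finally have ea: "e * (1 / e) powr a = 1 / 16" .
  have La: "(1 / L) powr a = 1 / 16"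
    using L a by (simp add: powr_divide) (simp add: L_def powr_powr)
  have "\<forall>\<^sub>F u in at_right 0. \<Phi> (1 / e * u) / \<Phi> u < 2 * (1 / e) powr a"
    using e by (intro order_tendstoD(2)[OF regularly_varying_scaling[OF l equiv]]) auto
  moreover have "\<forall>\<^sub>F u in at_right 0. \<Phi> (1 / L * u) / \<Phi> u < 2 * (1 / L) powr a"
    using L by (intro order_tendstoD(2)[OF regularly_varying_scaling[OF l equiv]]) auto
  ultimately have "\<forall>\<^sub>F u in at_right 0.
           \<Phi> u / 2 \<le> (LINT t:{0<..}|lborel. indicator {e / u..L / u} t * \<mu> t)"
    using regularly_varying_pos[OF l equiv] eventually_at_right_less[of 0]
  proof eventually_elim
    case (elim u)
    have "\<Phi> (u / e) < 2 * (1 / e) powr a * \<Phi> u"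
      using elim(1,3) by (simp add: divide_less_eq)
    then have "2 * e * \<Phi> (u / e) < 2 * e * (2 * (1 / e) powr a * \<Phi> u)"
      using e by (intro mult_strict_left_mono) auto
    also have "\<dots> = 4 * (e * (1 / e) powr a) * \<Phi> u" by simp
    finally have "2 * e * \<Phi> (u / e) < \<Phi> u / 4" by (simp add: ea)
    moreover have "2 * \<Phi> (u / L) < \<Phi> u / 4"
      using elim(2,3) by (simp add: divide_less_eq La)
    ultimately show ?case
      using Bernstein_function_le_three_scales[OF elim(4) e L] by linarith
  qed
  then show ?thesis using e L by blast
qed

end

section \<open>The jump kernel\<close>

text \<open>Together with the integrability of \<open>min 1 t * \<mu> t\<close>, this makes the integral defining the
  jump kernel converge: near \<open>0\<close> the exponential beats every power of \<open>t\<close>.\<close>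

lemma powr_mult_exp_inverse_le:
  fixes r t :: real
  assumes "r > 0" "t > 0"
  shows "t powr (- real d / 2) * exp (- r\<^sup>2 / (4 * t)) \<le> max 1 ((4 * real (d + 1) / r\<^sup>2) ^ (d + 1)) * min 1 t"
proof (cases "t \<ge> 1")
  case True
  have "t powr (- real d / 2) \<le> t powr 0" using True by (intro powr_mono) auto
  then have "t powr (- real d / 2) * exp (- r\<^sup>2 / (4 * t)) \<le> 1 * 1"
    using assms by (intro mult_mono) auto
  then show ?thesis using True by (simp add: min_def le_max_iff_disj)
next
  case False
  let ?n = "d + 1"
  define s where "s = r\<^sup>2 / (4 * t)"
  have s: "s > 0" using assms by (simp add: s_def)
  \<comment> \<open>The power \<open>d + 1\<close> suffices: it leaves \<open>t\<^bsup>d / 2 + 1\<^esup> \<le> t\<close> after the singular factor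
    \<open>t\<^bsup>- d / 2\<^esup>\<close> has been cancelled.\<close>
  have "(s / ?n) ^ ?n \<le> (1 + s / ?n) ^ ?n" using s by (intro power_mono) auto
  also have "\<dots> \<le> exp s" using s by (intro exp_ge_one_plus_x_over_n_power_n) auto
  finally have "inverse (exp s) \<le> inverse ((s / ?n) ^ ?n)" using s by (intro le_imp_inverse_le) auto
  also have "inverse ((s / ?n) ^ ?n) = (4 * real ?n / r\<^sup>2) ^ ?n * t ^ ?n"
  proof -
    have "inverse (s / ?n) = 4 * real ?n / r\<^sup>2 * t" using assms by (simp add: s_def)
    then show ?thesis by (simp only: power_inverse[symmetric] power_mult_distrib)
  qed
  finally have *: "exp (- r\<^sup>2 / (4 * t)) \<le> (4 * real ?n / r\<^sup>2) ^ ?n * t ^ ?n"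
    by (simp add: s_def exp_minus)
  have "t powr (- real d / 2) * t ^ ?n = t powr (real d / 2) * t"
  proof -
    have "t powr (- real d / 2) * t ^ ?n = t powr (- real d / 2 + real ?n)"
      using assms by (simp only: powr_add powr_realpow)
    also have "- real d / 2 + real ?n = real d / 2 + 1" by simp
    finally show ?thesis using assms by (simp add: powr_add)
  qed
  also have "\<dots> \<le> 1 * t"
    using assms False by (intro mult_right_mono powr_le1) auto
  finally have **: "t powr (- real d / 2) * t ^ ?n \<le> t" by simp
  have "t powr (- real d / 2) * exp (- r\<^sup>2 / (4 * t))
      \<le> t powr (- real d / 2) * ((4 * real ?n / r\<^sup>2) ^ ?n * t ^ ?n)"
    by (intro mult_left_mono *) auto
  also have "\<dots> = (4 * real ?n / r\<^sup>2) ^ ?n * (t powr (- real d / 2) * t ^ ?n)"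
    by (simp only: mult.left_commute)
  also have "\<dots> \<le> (4 * real ?n / r\<^sup>2) ^ ?n * t" by (intro mult_left_mono **) auto
  also have "\<dots> \<le> max 1 ((4 * real ?n / r\<^sup>2) ^ ?n) * t" using assms by (intro mult_right_mono) auto
  finally show ?thesis using False by (simp only: min_def) simp
qed

lemma jump_kernel_eq_heat_kernel_integral:
  fixes h :: "'a::euclidean_space"
  shows "jump_kernel DIM('a) \<mu> (norm h) = (LINT t|lborel. heat_kernel t h * (indicator {0<..} t * \<mu> t))"
proof -
  have "jump_kernel DIM('a) \<mu> (norm h) = (LINT t|lborel. (4 * pi) powr (- real DIM('a) / 2) *
      (indicator {0<..} t * (t powr (- real DIM('a) / 2) * exp (- (norm h)\<^sup>2 / (4 * t)) * \<mu> t)))"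
    by (simp add: jump_kernel_def set_lebesgue_integral_def)
  also have "\<dots> = (LINT t|lborel. heat_kernel t h * (indicator {0<..} t * \<mu> t))"
    by (intro Bochner_Integration.integral_cong refl)
       (simp add: heat_kernel_def powr_mult indicator_def)
  finally show ?thesis .
qed

context
  fixes \<Phi> \<mu> :: "real \<Rightarrow> real"
  assumes pair: "complete_Bernstein_pair \<Phi> \<mu>"
begin

lemma Levy_density_indicator_nonneg: "0 \<le> indicator {0<..} t * \<mu> t"
  using Levy_density_nonneg[OF pair, of t] by (simp add: indicator_def)

lemma jump_kernel_nonneg: "0 \<le> jump_kernel d \<mu> r"
  unfolding jump_kernel_def set_lebesgue_integral_def
  using Levy_density_nonneg[OF pair]
  by (intro mult_nonneg_nonneg Bochner_Integration.integral_nonneg) (auto simp: indicator_def)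

lemma jump_kernel_norm_measurable:
  "(\<lambda>h::'a::euclidean_space. jump_kernel DIM('a) \<mu> (norm h)) \<in> borel_measurable borel"
proof -
  note [measurable] = Levy_density_measurable[OF pair]
  show ?thesis
    unfolding jump_kernel_eq_heat_kernel_integral
    by (intro lborel.borel_measurable_lebesgue_integral) measurable
qed

text \<open>If the integral on the right is infinite, the jump kernel takes the default value \<open>0\<close> of a
  divergent Bochner integral, and the bound still holds.\<close>

lemma jump_kernel_le_nn_integral:
  fixes h :: "'a::euclidean_space"
  shows "ennreal (jump_kernel DIM('a) \<mu> (norm h))
     \<le> (\<integral>\<^sup>+ t. ennreal (heat_kernel t h * (indicator {0<..} t * \<mu> t)) \<partial>lborel)"
proof -
  let ?f = "\<lambda>t. heat_kernel t h * (indicator {0<..} t * \<mu> t)"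
  have nn: "0 \<le> ?f t" for t
    by (rule mult_nonneg_nonneg[OF heat_kernel_nonneg Levy_density_indicator_nonneg])
  show ?thesis
    unfolding jump_kernel_eq_heat_kernel_integral
    by (cases "integrable lborel ?f")
       (simp_all add: nn_integral_eq_integral[OF _ AE_I2[OF nn]] not_integrable_integral_eq)
qed

text \<open>By Tonelli the heat kernel estimate may be integrated against \<open>\<mu>\<close>, and
  \<open>1 - exp (- t / r\<^sup>2)\<close> integrates to \<open>\<Phi> (1 / r\<^sup>2)\<close>.\<close>

lemma nn_integral_truncated_second_moment_jump_kernel_le:
  assumes r: "r > 0"
  shows "(\<integral>\<^sup>+ h. ennreal (min 1 ((norm h)\<^sup>2 / r\<^sup>2) * jump_kernel DIM('a) \<mu> (norm h)) \<partial>(lborel :: 'a::euclidean_space measure))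
     \<le> ennreal (16 * 2 powr (real DIM('a) / 2) * \<Phi> (1 / r\<^sup>2))" (is "?I \<le> ennreal (?c * _)")
proof -
  note [measurable] = Levy_density_measurable[OF pair]
  let ?m = "\<lambda>t. indicator {0<..} t * \<mu> t"
  let ?W = "\<lambda>h::'a. min 1 ((norm h)\<^sup>2 / r\<^sup>2)"
  have W: "0 \<le> ?W h" for h by simp
  have "?I \<le> (\<integral>\<^sup>+ h. ennreal (?W h) * (\<integral>\<^sup>+ t. ennreal (heat_kernel t h * ?m t) \<partial>lborel) \<partial>lborel)"
    using jump_kernel_le_nn_integral[where ?'a = 'a] jump_kernel_nonneg
    by (intro nn_integral_mono) (simp add: ennreal_mult mult_left_mono)
  also have "\<dots> = (\<integral>\<^sup>+ h. \<integral>\<^sup>+ t. ennreal (?W h * (heat_kernel t h * ?m t)) \<partial>lborel \<partial>lborel)"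
    by (subst nn_integral_cmult[symmetric]) (simp_all add: ennreal_mult'[OF W])
  also have "\<dots> = (\<integral>\<^sup>+ t. \<integral>\<^sup>+ h. ennreal (?W h * (heat_kernel t h * ?m t)) \<partial>lborel \<partial>lborel)"
    by (rule lborel_pair.Fubini'[symmetric]) measurable
  also have "\<dots> \<le> (\<integral>\<^sup>+ t. ennreal (?c * (indicator {0<..} t * ((1 - exp (- (1 / r\<^sup>2) * t)) * \<mu> t))) \<partial>lborel)"
  proof (rule nn_integral_mono)
    fix t :: real
    show "(\<integral>\<^sup>+ h. ennreal (?W h * (heat_kernel t h * ?m t)) \<partial>lborel)
       \<le> ennreal (?c * (indicator {0<..} t * ((1 - exp (- (1 / r\<^sup>2) * t)) * \<mu> t)))"
    proof (cases "t > 0")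
      case True
      then have \<mu>: "0 \<le> \<mu> t" using Levy_density_nonneg[OF pair] by simp
      have "(\<integral>\<^sup>+ h. ennreal (?W h * (heat_kernel t h * ?m t)) \<partial>lborel)
          = (\<integral>\<^sup>+ h. ennreal (\<mu> t) * ennreal (?W h * heat_kernel t h) \<partial>lborel)"
        using True by (simp add: ennreal_mult'[OF \<mu>, symmetric] mult_ac)
      also have "\<dots> = ennreal (\<mu> t) * (\<integral>\<^sup>+ h. ennreal (?W h * heat_kernel t h) \<partial>lborel)"
        by (intro nn_integral_cmult) measurable
      also have "\<dots> \<le> ennreal (\<mu> t) * ennreal (?c * (1 - exp (- (1 / r\<^sup>2) * t)))"
        by (intro mult_left_mono truncated_second_moment_heat_kernel_le True r) auto
      also have "\<dots> = ennreal (?c * (indicator {0<..} t * ((1 - exp (- (1 / r\<^sup>2) * t)) * \<mu> t)))"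
        using True \<mu> by (subst ennreal_mult[symmetric]) (auto simp: mult_ac)
      finally show ?thesis .
    qed simp
  qed
  also have "\<dots> = ennreal (LINT t|lborel. ?c * (indicator {0<..} t * ((1 - exp (- (1 / r\<^sup>2) * t)) * \<mu> t)))"
  proof (rule nn_integral_eq_integral)
    show "integrable lborel (\<lambda>t. ?c * (indicator {0<..} t * ((1 - exp (- (1 / r\<^sup>2) * t)) * \<mu> t)))"
      using Bernstein_integrable[OF pair, of "1 / r\<^sup>2"] r by (simp add: set_integrable_def)
    show "AE t in lborel. 0 \<le> ?c * (indicator {0<..} t * ((1 - exp (- (1 / r\<^sup>2) * t)) * \<mu> t))"
      using Levy_density_nonneg[OF pair] by (intro AE_I2) (auto simp: indicator_def intro!: mult_nonneg_nonneg)
  qed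
  also have "(LINT t|lborel. ?c * (indicator {0<..} t * ((1 - exp (- (1 / r\<^sup>2) * t)) * \<mu> t))) = ?c * \<Phi> (1 / r\<^sup>2)"
    using pair r by (simp add: complete_Bernstein_pair_def set_lebesgue_integral_def)
  finally show ?thesis .
qed

lemma
  assumes r: "r > 0"
  shows truncated_second_moment_jump_kernel_integrable:
      "integrable lborel (\<lambda>h::'a::euclidean_space. min 1 ((norm h)\<^sup>2 / r\<^sup>2) * jump_kernel DIM('a) \<mu> (norm h))"
    and truncated_second_moment_jump_kernel_le:
      "(LINT h|lborel. min 1 ((norm (h::'a))\<^sup>2 / r\<^sup>2) * jump_kernel DIM('a) \<mu> (norm h))
        \<le> 16 * 2 powr (real DIM('a) / 2) * \<Phi> (1 / r\<^sup>2)"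
proof -
  note [measurable] = jump_kernel_norm_measurable
  let ?f = "\<lambda>h::'a. min 1 ((norm h)\<^sup>2 / r\<^sup>2) * jump_kernel DIM('a) \<mu> (norm h)"
  have nn: "0 \<le> ?f h" for h using jump_kernel_nonneg by simp
  note le = nn_integral_truncated_second_moment_jump_kernel_le[OF r, where ?'a = 'a]
  show i: "integrable lborel ?f"
    using nn le by (intro integrableI_bounded) (auto simp: le_less_trans)
  have "0 \<le> \<Phi> (1 / r\<^sup>2)"
    using pair r Levy_density_nonneg[OF pair]
    by (auto simp: complete_Bernstein_pair_def set_lebesgue_integral_def indicator_def
        intro!: Bochner_Integration.integral_nonneg)
  then show "(LINT h|lborel. ?f h) \<le> 16 * 2 powr (real DIM('a) / 2) * \<Phi> (1 / r\<^sup>2)"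
    using le nn unfolding nn_integral_eq_integral[OF i AE_I2[OF nn]] by (subst (asm) ennreal_le_iff) auto
qed

text \<open>Only the times between \<open>a\<close> and \<open>b\<close> are kept; there \<open>t\<^bsup>- d / 2\<^esup>\<close> is least at \<open>b\<close> and the
  exponential is least at \<open>a\<close>.\<close>

lemma jump_kernel_ge:
  assumes r: "r > 0" and a: "a > 0" and b: "b > 0"
  shows "(4 * pi * b) powr (- real d / 2) * exp (- r\<^sup>2 / (4 * a)) * (LINT t:{0<..}|lborel. indicator {a..b} t * \<mu> t)
     \<le> jump_kernel d \<mu> r"
proof -
  let ?k = "b powr (- real d / 2) * exp (- r\<^sup>2 / (4 * a))"
  have "?k * (LINT t:{0<..}|lborel. indicator {a..b} t * \<mu> t) = (LINT t:{0<..}|lborel. ?k * (indicator {a..b} t * \<mu> t))"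
    by simp
  also have "\<dots> \<le> (LINT t:{0<..}|lborel. t powr (- real d / 2) * exp (- r\<^sup>2 / (4 * t)) * \<mu> t)"
  proof (rule set_integral_mono)
    show "set_integrable lborel {0<..} (\<lambda>t. ?k * (indicator {a..b} t * \<mu> t))"
      using Levy_density_integrable_Icc[OF pair a] by (intro set_integrable_mult_right) auto
    show "set_integrable lborel {0<..} (\<lambda>t. t powr (- real d / 2) * exp (- r\<^sup>2 / (4 * t)) * \<mu> t)"
      using powr_mult_exp_inverse_le[OF r, where d = d]
      by (intro Levy_density_integrable_if_dominated[OF pair]) (auto simp: abs_mult)
    fix t :: real assume "t \<in> {0<..}"
    then have t: "t > 0" by simp
    have "?k * indicator {a..b} t \<le> t powr (- real d / 2) * exp (- r\<^sup>2 / (4 * t))"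
    proof (cases "t \<in> {a..b}")
      case True
      then have "b powr (- real d / 2) \<le> t powr (- real d / 2)"
        using t by (intro powr_mono2') auto
      moreover have "exp (- r\<^sup>2 / (4 * a)) \<le> exp (- r\<^sup>2 / (4 * t))"
        using True a t by (auto simp: divide_left_mono)
      ultimately show ?thesis using True by (auto intro: mult_mono)
    qed simp
    from mult_right_mono[OF this Levy_density_nonneg[OF pair t]]
    show "?k * (indicator {a..b} t * \<mu> t) \<le> t powr (- real d / 2) * exp (- r\<^sup>2 / (4 * t)) * \<mu> t"
      by (simp add: mult_ac)
  qed
  finally have "(4 * pi) powr (- real d / 2) * (?k * (LINT t:{0<..}|lborel. indicator {a..b} t * \<mu> t)) \<le> jump_kernel d \<mu> r"
    unfolding jump_kernel_def by (intro mult_left_mono) auto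
  moreover have "(4 * pi * b) powr (- real d / 2) = (4 * pi) powr (- real d / 2) * b powr (- real d / 2)"
    using b by (simp add: powr_mult)
  ultimately show ?thesis by (simp add: mult.assoc)
qed

end

section \<open>Second differences against the jump kernel\<close>

text \<open>The measure is invariant under \<open>h \<mapsto> a + h\<close> and \<open>h \<mapsto> a - h\<close>, so measurability and almost
  everywhere bounds of a function pass to its second differences in the variable \<open>h\<close>.\<close>

lemma
  fixes a :: "'a::euclidean_space"
  assumes s: "\<bar>s\<bar> = 1"
  shows measurable_lebesgue_reflection: "(\<lambda>h. a + s *\<^sub>R h) \<in> lebesgue \<rightarrow>\<^sub>M lebesgue"
    and distr_lebesgue_reflection: "distr lebesgue lebesgue (\<lambda>h. a + s *\<^sub>R h) = lebesgue"
proof -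
  have T: "(\<Sum>j\<in>Basis. (s * (x \<bullet> j)) *\<^sub>R j) = s *\<^sub>R x" for x :: 'a
    by (simp only: scaleR_scaleR[symmetric] scaleR_sum_right[symmetric] euclidean_representation)
  have "s \<noteq> 0" using s by auto
  then show "(\<lambda>h. a + s *\<^sub>R h) \<in> lebesgue \<rightarrow>\<^sub>M lebesgue"
    using lebesgue_affine_measurable[of "\<lambda>_. s" a] by (simp add: T)
  show "distr lebesgue lebesgue (\<lambda>h. a + s *\<^sub>R h) = lebesgue"
    using lebesgue_affine_euclidean[of "\<lambda>_. s" a] \<open>s \<noteq> 0\<close> s by (simp add: T density_1)
qed

lemma AE_lebesgue_reflection:
  fixes a :: "'a::euclidean_space"
  assumes "\<bar>s\<bar> = 1" "AE x in lebesgue. P x"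
  shows "AE h in lebesgue. P (a + s *\<^sub>R h)"
proof (rule AE_distrD[OF measurable_lebesgue_reflection[OF assms(1)]])
  show "AE x in distr lebesgue lebesgue (\<lambda>h. a + s *\<^sub>R h). P x"
    unfolding distr_lebesgue_reflection[OF assms(1)] by (rule assms(2))
qed

lemma Linfty_second_diff:
  fixes f :: "'a::euclidean_space \<Rightarrow> real"
  assumes "Linfty lebesgue f"
  shows "Linfty lebesgue (\<lambda>h. second_diff h f x)"
proof -
  from assms have [measurable]: "f \<in> borel_measurable lebesgue" by (simp add: Linfty_def)
  from assms obtain K where K: "AE x in lebesgue. \<bar>f x\<bar> \<le> K" by (auto simp: Linfty_def)
  have m: "(\<lambda>h. f (x + s *\<^sub>R h)) \<in> borel_measurable lebesgue" if "\<bar>s\<bar> = 1" for s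
    using measurable_compose[OF measurable_lebesgue_reflection[OF that] \<open>f \<in> _\<close>] .
  have "(\<lambda>h. second_diff h f x) \<in> borel_measurable lebesgue"
    using m[of 1] m[of "- 1"] by (simp add: second_diff_def)
  moreover have "AE h in lebesgue. \<bar>second_diff h f x\<bar> \<le> 2 * K + 2 * \<bar>f x\<bar>"
    using AE_lebesgue_reflection[OF _ K, of 1 x] AE_lebesgue_reflection[OF _ K, of "- 1" x]
    by (auto simp: second_diff_def elim!: eventually_elim2)
  ultimately show ?thesis unfolding Linfty_def by blast
qed

lemma truncated_quadratic_bounds:
  fixes h x :: "'a::real_normed_vector"
  assumes "0 < c" "c < 1" "x \<noteq> 0"
  shows truncated_quadratic_near: "norm h < c * norm x \<Longrightarrow> min 1 ((norm h)\<^sup>2 / (norm x)\<^sup>2) = (norm h)\<^sup>2 / (norm x)\<^sup>2"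
    and truncated_quadratic_far: "c * norm x \<le> norm h \<Longrightarrow> 1 \<le> min 1 ((norm h)\<^sup>2 / (norm x)\<^sup>2) / c\<^sup>2"
proof -
  assume "norm h < c * norm x"
  also have "\<dots> \<le> norm x" using assms by (simp add: mult_left_le_one_le)
  finally have "(norm h)\<^sup>2 \<le> (norm x)\<^sup>2" by (intro power_mono) auto
  then show "min 1 ((norm h)\<^sup>2 / (norm x)\<^sup>2) = (norm h)\<^sup>2 / (norm x)\<^sup>2"
    using assms by (simp add: min_def divide_le_eq)
next
  assume "c * norm x \<le> norm h"
  then have "(c * norm x)\<^sup>2 \<le> (norm h)\<^sup>2" using assms by (intro power_mono) auto
  then have "c\<^sup>2 \<le> (norm h)\<^sup>2 / (norm x)\<^sup>2" using assms by (simp add: le_divide_eq power_mult_distrib)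
  moreover have "c\<^sup>2 \<le> 1" using assms by (simp add: power_le_one)
  ultimately show "1 \<le> min 1 ((norm h)\<^sup>2 / (norm x)\<^sup>2) / c\<^sup>2" using assms by (simp add: le_divide_eq)
qed

text \<open>For small \<open>h\<close> the Zygmund bound applies, for large \<open>h\<close> the second difference is at least
  \<open>\<phi> (x + h) - 2 \<phi> x\<close>. Both losses are dominated by one truncated quadratic, whose integral
  against the jump kernel is under control, while the bulk of \<open>\<phi>\<close> over the set \<open>U\<close>, which lies far
  from \<open>x\<close>, is kept as a gain.\<close>

lemma second_diff_lower_bound:
  fixes x y h :: "'a::real_normed_vector"
  assumes pos: "\<And>y. 0 \<le> \<phi> y"
    and c: "0 < c" "c < 1" and x: "x \<noteq> 0"
    and near: "\<And>h. norm h < c * norm x \<Longrightarrow> \<bar>second_diff h \<phi> x\<bar> \<le> A * ((norm h)\<^sup>2 / (norm x)\<^sup>2)"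
    and far: "2 * \<phi> x \<le> B" and AB: "0 \<le> A" "0 \<le> B"
    and low: "\<And>y. y \<in> U \<Longrightarrow> \<delta> \<le> \<phi> y"
    and U: "\<And>y. y \<in> U \<Longrightarrow> c * norm x \<le> norm (y - x)"
  shows "- (A + B / c\<^sup>2) * min 1 ((norm h)\<^sup>2 / (norm x)\<^sup>2) + \<delta> * indicator U (x + h) \<le> second_diff h \<phi> x"
proof -
  let ?W = "min 1 ((norm h)\<^sup>2 / (norm x)\<^sup>2)"
  have W: "0 \<le> ?W" by simp
  show ?thesis
  proof (cases "norm h < c * norm x")
    case True
    then have "x + h \<notin> U" using U[of "x + h"] by auto
    moreover have "\<bar>second_diff h \<phi> x\<bar> \<le> A * ?W"
      using near[OF True] truncated_quadratic_near[OF c x True] by simp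
    moreover have "0 \<le> B / c\<^sup>2 * ?W" using AB W by simp
    ultimately show ?thesis by (simp add: algebra_simps)
  next
    case False
    then have "1 \<le> ?W / c\<^sup>2" using truncated_quadratic_far[OF c x, of h] by simp
    then have "B * 1 \<le> B * (?W / c\<^sup>2)" using AB by (intro mult_left_mono)
    moreover have "0 \<le> A * ?W" using AB W by simp
    moreover have "\<delta> * indicator U (x + h) \<le> \<phi> (x + h)"
      using low pos by (simp add: indicator_def)
    ultimately show ?thesis using far pos[of "x - h"]
      by (simp add: second_diff_def algebra_simps)
  qed
qed

text \<open>The balance behind the theorem. The gain is the lower bound \<open>\<delta>\<close> of \<open>\<phi>\<close> on a unit ball, carried
  to \<open>x\<close> by jumps of density at least \<open>J\<close>; the loss is the size of \<open>\<phi>\<close> and of its second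
  differences near \<open>x\<close>, times \<open>\<Phi> (1 / |x|\<^sup>2)\<close>.\<close>

lemma second_diff_jump_integral_lower_bound:
  fixes \<phi> :: "'a::euclidean_space \<Rightarrow> real"
  assumes pair: "complete_Bernstein_pair \<Phi> \<mu>" and bdd: "Linfty lebesgue \<phi>"
    and pos: "\<And>y. 0 \<le> \<phi> y"
    and c: "0 < c" "c < 1" and x: "x \<noteq> 0"
    and near: "\<And>h. norm h < c * norm x \<Longrightarrow> \<bar>second_diff h \<phi> x\<bar> \<le> A * ((norm h)\<^sup>2 / (norm x)\<^sup>2)"
    and far: "2 * \<phi> x \<le> B" and AB: "0 \<le> A" "0 \<le> B"
    and low: "\<And>y. y \<in> ball z 1 \<Longrightarrow> \<delta> \<le> \<phi> y" and \<delta>: "0 \<le> \<delta>"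
    and z: "\<And>y. y \<in> ball z 1 \<Longrightarrow> c * norm x \<le> norm (y - x)"
    and j: "\<And>y. y \<in> ball z 1 \<Longrightarrow> J \<le> jump_kernel DIM('a) \<mu> (norm (y - x))"
  shows "integrable lebesgue (\<lambda>h. second_diff h \<phi> x * jump_kernel DIM('a) \<mu> (norm h))"
    and "\<delta> * J * measure lborel (ball (0::'a) 1) - (A + B / c\<^sup>2) * (16 * 2 powr (real DIM('a) / 2) * \<Phi> (1 / (norm x)\<^sup>2))
       \<le> (LINT h|lebesgue. second_diff h \<phi> x * jump_kernel DIM('a) \<mu> (norm h))"
proof -
  let ?j = "\<lambda>h::'a. jump_kernel DIM('a) \<mu> (norm h)"
  let ?W = "\<lambda>h::'a. min 1 ((norm h)\<^sup>2 / (norm x)\<^sup>2)"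
  have jm: "?j \<in> borel_measurable borel" by (rule jump_kernel_norm_measurable[OF pair])
  note [measurable] = this
  have nx: "norm x > 0" using x by simp
  have j0: "0 \<le> ?j h" for h by (rule jump_kernel_nonneg[OF pair])
  have WJ: "integrable lebesgue (\<lambda>h. ?W h * ?j h)"
    using truncated_second_moment_jump_kernel_integrable[OF pair nx, where ?'a = 'a]
    by (subst integrable_completion) measurable
  have WJle: "(LINT h|lebesgue. ?W h * ?j h) \<le> 16 * 2 powr (real DIM('a) / 2) * \<Phi> (1 / (norm x)\<^sup>2)"
    using truncated_second_moment_jump_kernel_le[OF pair nx, where ?'a = 'a]
    by (subst integral_completion) measurable
  from Linfty_second_diff[OF bdd, of x] obtain K
    where Dm: "(\<lambda>h. second_diff h \<phi> x) \<in> borel_measurable lebesgue"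
      and K: "AE h in lebesgue. \<bar>second_diff h \<phi> x\<bar> \<le> K"
    unfolding Linfty_def by blast
  have jm': "?j \<in> borel_measurable lebesgue" using jm by (intro measurable_completion) simp
  show DJ: "integrable lebesgue (\<lambda>h. second_diff h \<phi> x * ?j h)"
  proof (rule Bochner_Integration.integrable_bound[OF integrable_mult_right[of "A + \<bar>K\<bar> / c\<^sup>2", OF WJ]])
    show "(\<lambda>h. second_diff h \<phi> x * ?j h) \<in> borel_measurable lebesgue"
      using Dm jm' by (rule borel_measurable_times)
    show "AE h in lebesgue. norm (second_diff h \<phi> x * ?j h) \<le> norm ((A + \<bar>K\<bar> / c\<^sup>2) * (?W h * ?j h))"
      using K
    proof eventually_elim
      case (elim h)
      have W: "0 \<le> ?W h" by simp
      have "\<bar>second_diff h \<phi> x\<bar> \<le> A * ?W h + \<bar>K\<bar> / c\<^sup>2 * ?W h"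
      proof (cases "norm h < c * norm x")
        case True
        have "\<bar>second_diff h \<phi> x\<bar> \<le> A * ?W h"
          using near[OF True] truncated_quadratic_near[OF c x True] by simp
        moreover have "0 \<le> \<bar>K\<bar> / c\<^sup>2 * ?W h" using W by simp
        ultimately show ?thesis by linarith
      next
        case False
        then have "1 \<le> ?W h / c\<^sup>2" using truncated_quadratic_far[OF c x, of h] by simp
        then have "\<bar>K\<bar> * 1 \<le> \<bar>K\<bar> * (?W h / c\<^sup>2)" by (intro mult_left_mono) auto
        moreover have "0 \<le> A * ?W h" using AB W by simp
        ultimately show ?thesis using elim by simp
      qed
      then have "\<bar>second_diff h \<phi> x\<bar> * ?j h \<le> (A * ?W h + \<bar>K\<bar> / c\<^sup>2 * ?W h) * ?j h"
        by (intro mult_right_mono j0)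
      also have "\<dots> = (A + \<bar>K\<bar> / c\<^sup>2) * (?W h * ?j h)" by (simp add: algebra_simps)
      finally have "norm (second_diff h \<phi> x * ?j h) \<le> (A + \<bar>K\<bar> / c\<^sup>2) * (?W h * ?j h)"
        using j0[of h] by (simp add: abs_mult)
      then show ?case by (rule order_trans) (simp only: real_norm_def abs_ge_self)
    qed
  qed
  \<comment> \<open>The ball seen from \<open>x\<close>: its volume does not depend on \<open>x\<close>.\<close>
  have eq: "(\<lambda>h. indicator (ball z 1) (x + h)) = (indicator (ball (z - x) 1) :: 'a \<Rightarrow> real)"
    by (auto simp: indicator_def dist_norm algebra_simps)
  have I: "integrable lebesgue (indicator (ball (z - x) 1) :: 'a \<Rightarrow> real)"
    using emeasure_lborel_ball_finite[of "z - x" 1] by auto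
  have ball: "measure lborel (ball (z - x) 1) = measure lborel (ball (0::'a) 1)"
    using content_ball_conv_unit_ball[of 1 "z - x"] by simp
  have "\<delta> * J * measure lborel (ball (0::'a) 1) - (A + B / c\<^sup>2) * (16 * 2 powr (real DIM('a) / 2) * \<Phi> (1 / (norm x)\<^sup>2))
      \<le> \<delta> * J * measure lborel (ball (0::'a) 1) - (A + B / c\<^sup>2) * (LINT h|lebesgue. ?W h * ?j h)"
    using AB c by (intro diff_left_mono mult_left_mono WJle) auto
  also have "\<dots> = (LINT h|lebesgue. \<delta> * J * indicator (ball (z - x) 1) h - (A + B / c\<^sup>2) * (?W h * ?j h))"
    using I WJ by (simp add: ball)
  also have "\<dots> \<le> (LINT h|lebesgue. second_diff h \<phi> x * ?j h)"
  proof (rule integral_mono[OF _ DJ])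
    show "integrable lebesgue (\<lambda>h. \<delta> * J * indicator (ball (z - x) 1) h - (A + B / c\<^sup>2) * (?W h * ?j h))"
      using I WJ by (intro Bochner_Integration.integrable_diff integrable_mult_right)
    fix h :: 'a
    have "(- (A + B / c\<^sup>2) * ?W h + \<delta> * indicator (ball z 1) (x + h)) * ?j h \<le> second_diff h \<phi> x * ?j h"
      by (intro mult_right_mono j0 second_diff_lower_bound pos c x near far AB low z)
    moreover have "\<delta> * J * indicator (ball z 1) (x + h) \<le> \<delta> * indicator (ball z 1) (x + h) * ?j h"
      using j[of "x + h"] \<delta> by (auto simp: indicator_def mult_left_mono)
    ultimately show "\<delta> * J * indicator (ball (z - x) 1) h - (A + B / c\<^sup>2) * (?W h * ?j h) \<le> second_diff h \<phi> x * ?j h"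
      unfolding fun_cong[OF eq, symmetric] by (simp add: algebra_simps)
  qed
  finally show "\<delta> * J * measure lborel (ball (0::'a) 1) - (A + B / c\<^sup>2) * (16 * 2 powr (real DIM('a) / 2) * \<Phi> (1 / (norm x)\<^sup>2))
      \<le> (LINT h|lebesgue. second_diff h \<phi> x * ?j h)" .
qed

section \<open>Positivity of the potential\<close>

lemma filterlim_inverse_square_at_right_0: "filterlim (\<lambda>R::real. 1 / R\<^sup>2) (at_right 0) at_top"
  unfolding divide_inverse mult_1
  by (intro filterlim_compose[OF filterlim_inverse_at_right_top] filterlim_pow_at_top filterlim_ident) simp

text \<open>With \<open>u = 1 / R\<^sup>2\<close> the relevant jump times are those comparable with \<open>R\<^sup>2\<close>. At such times the
  heat kernel is of order \<open>R\<^bsup>- d\<^esup>\<close> on the whole ball of radius \<open>2 R\<close>.\<close>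

lemma jump_kernel_ge_Bernstein_function:
  assumes pair: "complete_Bernstein_pair \<Phi> \<mu>"
    and l: "slowly_varying_at_zero l"
    and equiv: "\<Phi> \<sim>[at_right 0] (\<lambda>u. u powr a * l u)"
    and a: "0 < a" "a < 1"
  shows "\<exists>k>0. \<forall>\<^sub>F R in at_top. \<forall>r. 0 < r \<longrightarrow> r \<le> 2 * R \<longrightarrow>
           k * R powr (- real d) * \<Phi> (1 / R\<^sup>2) \<le> jump_kernel d \<mu> r"
proof -
  obtain e L where e: "e > 0" and L: "L > 0"
    and mass: "\<forall>\<^sub>F u in at_right 0. \<Phi> u / 2 \<le> (LINT t:{0<..}|lborel. indicator {e / u..L / u} t * \<mu> t)"
    using Levy_mass_ge_Bernstein_function[OF pair l equiv a] by blast
  define k where "k = (4 * pi * L) powr (- real d / 2) * exp (- 1 / e) / 2"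
  have k: "k > 0" using L by (simp add: k_def)
  from filterlim_iff[THEN iffD1, OF filterlim_inverse_square_at_right_0, rule_format, OF mass]
  have "\<forall>\<^sub>F R in at_top. \<forall>r. 0 < r \<longrightarrow> r \<le> 2 * R \<longrightarrow>
           k * R powr (- real d) * \<Phi> (1 / R\<^sup>2) \<le> jump_kernel d \<mu> r"
    using eventually_gt_at_top[of 0]
  proof eventually_elim
    case (elim R)
    let ?m = "LINT t:{0<..}|lborel. indicator {e * R\<^sup>2..L * R\<^sup>2} t * \<mu> t"
    have m: "\<Phi> (1 / R\<^sup>2) / 2 \<le> ?m" using elim by simp
    have m0: "0 \<le> ?m"
      using Levy_density_nonneg[OF pair]
      by (auto simp: set_lebesgue_integral_def indicator_def intro!: Bochner_Integration.integral_nonneg)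
    show ?case
    proof (intro allI impI)
      fix r assume r: "0 < r" "r \<le> 2 * R"
      have "r\<^sup>2 \<le> (2 * R)\<^sup>2" using r by (intro power_mono) auto
      then have exp_le: "exp (- 1 / e) \<le> exp (- r\<^sup>2 / (4 * (e * R\<^sup>2)))"
        using e elim(2) by (simp add: divide_le_eq)
      have "(R powr 2) powr (- real d / 2) = R powr (- real d)" by (simp add: powr_powr)
      then have "R powr (- real d) = (R\<^sup>2) powr (- real d / 2)" using elim(2) by simp
      then have scale: "(4 * pi * L) powr (- real d / 2) * R powr (- real d) = (4 * pi * (L * R\<^sup>2)) powr (- real d / 2)"
        using L elim(2) by (simp only: mult.assoc[symmetric]) (simp add: powr_mult)
      have "k * R powr (- real d) * \<Phi> (1 / R\<^sup>2)
          = (4 * pi * (L * R\<^sup>2)) powr (- real d / 2) * exp (- 1 / e) * (\<Phi> (1 / R\<^sup>2) / 2)"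
        unfolding scale[symmetric] by (simp add: k_def)
      also have "\<dots> \<le> (4 * pi * (L * R\<^sup>2)) powr (- real d / 2) * exp (- 1 / e) * ?m"
        by (intro mult_left_mono m) auto
      also have "\<dots> \<le> (4 * pi * (L * R\<^sup>2)) powr (- real d / 2) * exp (- r\<^sup>2 / (4 * (e * R\<^sup>2))) * ?m"
        by (intro mult_right_mono mult_left_mono exp_le m0) auto
      also have "\<dots> \<le> jump_kernel d \<mu> r"
        using e L elim(2) r by (intro jump_kernel_ge[OF pair]) auto
      finally show "k * R powr (- real d) * \<Phi> (1 / R\<^sup>2) \<le> jump_kernel d \<mu> r" .
    qed
  qed
  then show ?thesis using k by blast
qed

lemma eventually_powr_greater:
  fixes p :: real
  assumes "p > 0"
  shows "\<forall>\<^sub>F x in at_top. c < x powr p"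
  using eventually_gt_at_top[of "max 1 c powr (1 / p)"]
proof eventually_elim
  case (elim x)
  have "c \<le> (max 1 c powr (1 / p)) powr p" using assms by (simp add: powr_powr)
  also have "\<dots> < x powr p" using elim assms by (intro powr_less_mono2) auto
  finally show ?case .
qed

theorem theorem6p1:
  fixes \<Phi> \<mu> l \<rho> :: "real \<Rightarrow> real"
    and V \<phi> L\<^sub>\<phi> :: "'a::euclidean_space \<Rightarrow> real"
    and M\<^sub>\<phi> \<alpha> \<kappa> C1 C2 C3 C4 M1 M2 :: real
  assumes "complete_Bernstein_pair \<Phi> \<mu>"
    and "L2 lebesgue \<phi>" and "Linfty lebesgue \<phi>" and "\<forall>x. \<phi> x > 0"
    and "Schroedinger \<Phi> V \<phi> (\<lambda>x. 0)"
    and "potential_pointwise \<mu> \<phi> V"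
    and "0 < C1" and "C1 < 1"
    and "\<phi> \<in> Zspace C1" and "Zygmund_bound C1 \<phi> M\<^sub>\<phi> L\<^sub>\<phi>"
    and "0 < \<alpha>" and "\<alpha> < 2"
    and "slowly_varying_at_zero l"
    and "\<Phi> \<sim>[at_right 0] (\<lambda>u. u powr (\<alpha> / 2) * l u)"
    and "\<forall>r\<ge>0. \<rho> r \<ge> 0" and "antimono_on {0..} \<rho>"
    and "\<forall>x \<in> - ball 0 M\<^sub>\<phi>. \<phi> x = \<rho> (norm x)"
    and "C2 > 0" and "C3 > 0" and "M1 > 0"
    and "real DIM('a) / 2 < \<kappa>" and "\<kappa> < (real DIM('a) + \<alpha>) / 2"
    and "\<forall>x \<in> - ball 0 M1. C2 * norm x powr (- 2 * \<kappa>) \<le> \<phi> x \<and> \<phi> x \<le> C3 * norm x powr (- 2 * \<kappa>)"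
    and "C4 > 0" and "M2 > 0"
    and "\<forall>x \<in> - ball 0 M2. L\<^sub>\<phi> x \<le> C4 * norm x powr (- (2 * \<kappa> + 2))"
  shows "\<exists>M>0. \<forall>x \<in> - ball 0 M. V x > 0"
proof -
  note pair = assms(1) and bdd = assms(3) and pos = assms(4)[rule_format] and pointwise = assms(6)
    and C1 = assms(7,8) and zyg = assms(10) and \<alpha> = assms(11,12) and l = assms(13) and equiv = assms(14)
    and C = assms(18,19,24) and M1 = assms(20) and \<kappa> = assms(21)
    and decay = assms(23)[rule_format] and L\<phi> = assms(26)[rule_format]
  have a: "0 < \<alpha> / 2" "\<alpha> / 2 < 1" using \<alpha> by auto
  have \<kappa>0: "\<kappa> > 0" using \<kappa> by (rule le_less_trans[rotated]) simp
  obtain k where k: "k > 0" and jk: "\<forall>\<^sub>F R in at_top. \<forall>r. 0 < r \<longrightarrow> r \<le> 2 * R \<longrightarrow>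
       k * R powr (- real DIM('a)) * \<Phi> (1 / R\<^sup>2) \<le> jump_kernel DIM('a) \<mu> r"
    using jump_kernel_ge_Bernstein_function[OF pair l equiv a, of "DIM('a)"] by blast
  \<comment> \<open>The unit ball about \<open>z\<close> lies in the shell \<open>M1 \<le> |y| \<le> M1 + 2\<close>, where the lower decay bound
    keeps \<open>\<phi>\<close> above a positive constant \<open>\<delta>\<close>.\<close>
  obtain b :: 'a where b: "b \<in> Basis" using nonempty_Basis by blast
  define z where "z = (M1 + 1) *\<^sub>R b"
  have nz: "norm z = M1 + 1" using b M1 by (simp add: z_def)
  have z: "M1 \<le> norm y" "norm y \<le> M1 + 2" if "y \<in> ball z 1" for y
    using that nz norm_triangle_ineq2[of z y] norm_triangle_ineq2[of y z]
    by (auto simp: dist_norm norm_minus_commute)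
  define \<delta> where "\<delta> = C2 * (M1 + 2) powr (- 2 * \<kappa>)"
  have \<delta>: "\<delta> > 0" using C M1 by (simp add: \<delta>_def)
  have low: "\<delta> \<le> \<phi> y" if "y \<in> ball z 1" for y
  proof -
    have "(M1 + 2) powr (- 2 * \<kappa>) \<le> norm y powr (- 2 * \<kappa>)"
      using z[OF that] M1 \<kappa>0 by (intro powr_mono2') auto
    then have "\<delta> \<le> C2 * norm y powr (- 2 * \<kappa>)" using C by (simp add: \<delta>_def)
    also have "\<dots> \<le> \<phi> y" using z[OF that] decay[of y] by simp
    finally show ?thesis .
  qed
  define K where "K = C4 + 2 * C3 / C1\<^sup>2"
  define Q where "Q = 16 * 2 powr (real DIM('a) / 2)"
  define v where "v = measure lborel (ball (0::'a) 1)"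
  have v: "v > 0" unfolding v_def by (rule content_ball_pos) simp
  have small: "\<forall>\<^sub>F u in at_right 0. \<Phi> u > 0" by (rule regularly_varying_pos[OF l equiv])
  have \<Phi>pos: "\<forall>\<^sub>F R in at_top. \<Phi> (1 / R\<^sup>2) > 0"
    using filterlim_iff[THEN iffD1, OF filterlim_inverse_square_at_right_0, rule_format, OF small] .
  \<comment> \<open>The gain \<open>\<delta> k v R\<^bsup>- d\<^esup> \<Phi> (1 / R\<^sup>2)\<close> exceeds the loss \<open>K Q R\<^bsup>- 2 \<kappa>\<^esup> \<Phi> (1 / R\<^sup>2)\<close> precisely when this
    holds and \<open>\<Phi> (1 / R\<^sup>2) > 0\<close>.\<close>
  have "\<forall>\<^sub>F R in at_top. K * Q / (\<delta> * k * v) < R powr (2 * \<kappa> - real DIM('a))"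
    using \<kappa> by (intro eventually_powr_greater) simp
  with jk \<Phi>pos eventually_ge_at_top[of "M1 + 2"] eventually_ge_at_top[of M\<^sub>\<phi>] eventually_ge_at_top[of M2]
    eventually_ge_at_top[of "(M1 + 2) / (1 - C1)"]
  have "\<forall>\<^sub>F R in at_top. \<forall>x. norm x = R \<longrightarrow> V x > 0"
  proof eventually_elim
    case (elim R)
    show ?case
    proof (intro allI impI)
      fix x :: 'a assume x: "norm x = R"
      have R: "R > 0" using elim M1 by simp
      let ?u = "1 / (norm x)\<^sup>2"
      let ?D = "LINT h|lebesgue. second_diff h \<phi> x * jump_kernel DIM('a) \<mu> (norm h)"
      have near: "\<bar>second_diff h \<phi> x\<bar> \<le> (C4 * R powr (- 2 * \<kappa>)) * ((norm h)\<^sup>2 / (norm x)\<^sup>2)"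
        if h: "norm h < C1 * norm x" for h
      proof -
        have "\<bar>second_diff h \<phi> x\<bar> \<le> L\<^sub>\<phi> x * (norm h)\<^sup>2"
          using zyg h elim x by (simp add: Zygmund_bound_def)
        also have "\<dots> \<le> C4 * R powr (- (2 * \<kappa> + 2)) * (norm h)\<^sup>2"
          using L\<phi>[of x] elim x by (intro mult_right_mono) auto
        also have "R powr (- (2 * \<kappa> + 2)) = R powr (- 2 * \<kappa>) / R\<^sup>2"
          using R powr_diff[of R "- 2 * \<kappa>" 2] by simp
        finally show ?thesis by (simp add: x)
      qed
      have far: "2 * \<phi> x \<le> 2 * (C3 * R powr (- 2 * \<kappa>))"
        using decay[of x] elim x M1 by simp
      have dist: "C1 * norm x \<le> norm (y - x)" "norm (y - x) \<le> 2 * R" if "y \<in> ball z 1" for y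
      proof -
        have "M1 + 2 \<le> (1 - C1) * R" using elim C1 by (simp add: divide_le_eq mult.commute)
        then show "C1 * norm x \<le> norm (y - x)"
          using z[OF that] norm_triangle_ineq2[of x y] x by (simp add: norm_minus_commute algebra_simps)
        show "norm (y - x) \<le> 2 * R"
          using z[OF that] norm_triangle_ineq4[of y x] x elim by simp
      qed
      have j: "k * R powr (- real DIM('a)) * \<Phi> ?u \<le> jump_kernel DIM('a) \<mu> (norm (y - x))" if "y \<in> ball z 1" for y
      proof -
        have "0 < C1 * norm x" using C1 R x by simp
        then have "0 < norm (y - x)" using dist(1)[OF that] by linarith
        then show ?thesis using elim(1) dist(2)[OF that] x by blast
      qed
      have x0: "x \<noteq> 0" using R x by auto
      have AB: "0 \<le> C4 * R powr (- 2 * \<kappa>)" "0 \<le> 2 * (C3 * R powr (- 2 * \<kappa>))" using C by auto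
      have K: "C4 * R powr (- 2 * \<kappa>) + 2 * (C3 * R powr (- 2 * \<kappa>)) / C1\<^sup>2 = K * R powr (- 2 * \<kappa>)"
        by (simp add: K_def distrib_right)
      note bound = second_diff_jump_integral_lower_bound[OF pair bdd less_imp_le[OF pos] C1 x0 near far AB
          low less_imp_le[OF \<delta>] dist(1) j]
      have "\<delta> * (k * R powr (- real DIM('a)) * \<Phi> ?u) * v - K * R powr (- 2 * \<kappa>) * (Q * \<Phi> ?u) \<le> ?D"
        using bound(2) unfolding K Q_def v_def .
      moreover have "0 < \<delta> * (k * R powr (- real DIM('a)) * \<Phi> ?u) * v - K * R powr (- 2 * \<kappa>) * (Q * \<Phi> ?u)"
      proof -
        have "K * Q < R powr (2 * \<kappa> - real DIM('a)) * (\<delta> * k * v)"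
          using elim(7) \<delta> k v by (simp add: pos_divide_less_eq)
        then have "K * Q * (R powr (- 2 * \<kappa>) * \<Phi> ?u) < R powr (2 * \<kappa> - real DIM('a)) * (\<delta> * k * v) * (R powr (- 2 * \<kappa>) * \<Phi> ?u)"
          using elim(2) x R by (intro mult_strict_right_mono) auto
        also have "\<dots> = \<delta> * k * v * \<Phi> ?u * (R powr (2 * \<kappa> - real DIM('a)) * R powr (- 2 * \<kappa>))"
          by (simp only: mult_ac)
        also have "R powr (2 * \<kappa> - real DIM('a)) * R powr (- 2 * \<kappa>) = R powr (- real DIM('a))"
          by (simp add: powr_add[symmetric])
        finally show ?thesis by (simp only: diff_gt_0_iff_gt mult_ac)
      qed
      ultimately have "0 < ?D" by linarith
      moreover have "V x = 1 / (2 * \<phi> x) * ?D"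
        using pointwise bound(1) unfolding potential_pointwise_def by blast
      ultimately show "V x > 0" using pos[of x] by simp
    qed
  qed
  then obtain M where M: "\<And>R x. M \<le> R \<Longrightarrow> norm x = R \<Longrightarrow> V x > 0"
    unfolding eventually_at_top_linorder by blast
  have "\<forall>x \<in> - ball 0 (max M 1). V x > 0"
    using M[OF _ refl] by auto
  then show ?thesis by (intro exI[of _ "max M 1"]) auto
qed

end
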